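(* Let $n\ge1$, $\theta\in\mathbb R$ and $\tilde g=[\tilde g_1^\top,\dots,\tilde g_n^\top]^\top\in\mathbb R^{3n}$. The following are equivalent: (a) $(\tilde g,\theta)$ is non-singular, i.e. the linear map $\mathcal F:\mathbb R^3\times\mathbb R^3\to\mathbb R^{3n}$, $\mathcal F(s,\tau)=A(\tilde g,\theta)[s^\top,\tau^\top]^\top$, is injective; (b) $\mathrm{rank}(A(\tilde g,\theta))=6$; (c) $\dim(\Pi(\tilde g,\theta))=6$; (d) each of the sets $\{\tilde p^x_{i,\theta}\}_{i=1}^n$, $\{\tilde p^y_{i,\theta}\}_{i=1}^n$, $\{\tilde\phi_i\}_{i=1}^n$ affinely spans $\mathbb R$.
   Context: $R(\theta)=\begin{bmatrix}\cos\theta&-\sin\theta\\ \sin\theta&\cos\theta\end{bmatrix}$, $\Theta=\begin{bmatrix}R(\theta)&0\\0&1\end{bmatrix}$. Each $\tilde g_i=[\tilde p_i^\top,\tilde\phi_i]^\top\in\mathbb R^3$, and $\tilde g_{i,\theta}:=\Theta^\top\tilde g_i=[\tilde p^x_{i,\theta},\tilde p^y_{i,\theta},\tilde\phi_i]^\top$. $A(\tilde g,\theta)\in\mathbb R^{3n\times6}$ is the matrix whose $i$-th block row is $[\Theta\,\mathrm{diag}(\tilde g_{i,\theta})\ \ I_3]$. The target state space is $\Pi(\tilde g,\theta)=\{g\in\mathbb R^{3n}: g_i=\tau+\Theta\,\mathrm{diag}(s)\,\Theta^\top\tilde g_i,\ i=1,\dots,n,\ s,\tau\in\mathbb R^3\}$,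 which equals the image of $A(\tilde g,\theta)$. A set $\{x_i\}$ of reals affinely spans $\mathbb R$ if $\{\sum a_ix_i:\sum a_i=1\}=\mathbb R$, equivalently it contains two distinct elements. *)

theory Defs
  imports "HOL-Analysis.Analysis"
begin

text \<open>The agent index set is an arbitrary finite type 'n (so n = CARD('n) \<ge> 1).
  A vector in R^{3n} is an element of real^('n \<times> 3): entry (i,k) is the k-th
  coordinate of the i-th block. The parameter space R^3 \<times> R^3 is real^(3+3),
  with Inl indexing s and Inr indexing tau.\<close>

definition Rot :: "real \<Rightarrow> real^2^2" where
  "Rot \<theta> = vector [vector [cos \<theta>, - sin \<theta>], vector [sin \<theta>, cos \<theta>]]"

text \<open>Theta = [[R(theta), 0], [0, 1]], written out entrywise.\<close>
definition Theta :: "real \<Rightarrow> real^3^3" where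
  "Theta \<theta> = vector [vector [cos \<theta>, - sin \<theta>, 0],
                      vector [sin \<theta>, cos \<theta>, 0],
                      vector [0, 0, 1]]"

definition diagm :: "real^3 \<Rightarrow> real^3^3" where
  "diagm v = (\<chi> a b. if a = b then v $ a else 0)"

text \<open>i-th block g_i \<in> R^3 of g \<in> R^{3n}.\<close>
definition blk :: "real^('n::finite \<times> 3) \<Rightarrow> 'n \<Rightarrow> real^3" where
  "blk g i = (\<chi> k. g $ (i, k))"

text \<open>tilde g_{i,theta} = Theta^T tilde g_i.\<close>
definition gtheta :: "real^('n::finite \<times> 3) \<Rightarrow> real \<Rightarrow> 'n \<Rightarrow> real^3" where
  "gtheta g \<theta> i = transpose (Theta \<theta>) *v blk g i"

text \<open>A(g,theta) \<in> R^{3n x 6}: block row i is [Theta diag(g_{i,theta})  I_3].\<close>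
definition Amat :: "real^('n::finite \<times> 3) \<Rightarrow> real \<Rightarrow> real^(3 + 3)^('n \<times> 3)" where
  "Amat g \<theta> = (\<chi> r c. case r of (i, k) \<Rightarrow>
      (case c of Inl j \<Rightarrow> (Theta \<theta> ** diagm (gtheta g \<theta> i)) $ k $ j
               | Inr j \<Rightarrow> (if k = j then 1 else 0)))"

text \<open>Stacking [s; tau] \<in> R^6.\<close>
definition stack :: "real^3 \<Rightarrow> real^3 \<Rightarrow> real^(3 + 3)" where
  "stack s \<tau> = (\<chi> c. case c of Inl j \<Rightarrow> s $ j | Inr j \<Rightarrow> \<tau> $ j)"

text \<open>Target state space Pi(g,theta).\<close>
definition Pi_space :: "real^('n::finite \<times> 3) \<Rightarrow> real \<Rightarrow> (real^('n \<times> 3)) set" where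
  "Pi_space gt \<theta> = {g. \<exists>s \<tau> :: real^3. \<forall>i. blk g i =
       \<tau> + (Theta \<theta> ** diagm s ** transpose (Theta \<theta>)) *v blk gt i}"

text \<open>A family x_i of reals affinely spans R.\<close>
definition affinely_spans :: "('n::finite \<Rightarrow> real) \<Rightarrow> bool" where
  "affinely_spans x \<longleftrightarrow>
     {\<Sum>i\<in>UNIV. a i * x i | a. (\<Sum>i\<in>UNIV. a i) = 1} = (UNIV :: real set)"

end

theory Submission
  imports Defs
begin

text \<open>Substitute \<open>\<tau> = \<Theta> c\<close>. The \<open>i\<close>-th block of \<open>A [s; \<tau>]\<close> is then
  \<open>\<Theta> (diag(s) g\<^sub>i\<^sub>,\<^sub>\<theta> + c)\<close>, and since \<open>\<Theta>\<close> is orthogonal, \<open>A [s; \<tau>] = 0\<close> means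
  \<open>s\<^sub>k x\<^sub>i\<^sub>k + c\<^sub>k = 0\<close> for all \<open>i, k\<close>, where \<open>x\<^sub>i\<^sub>k\<close> is the \<open>k\<close>-th coordinate of
  \<open>g\<^sub>i\<^sub>,\<^sub>\<theta>\<close>. The kernel thus splits into three independent one-dimensional problems:
  an affine function \<open>a x + c\<close> vanishing at all points \<open>x\<^sub>1, \<dots>, x\<^sub>n\<close> is forced to be
  zero exactly when the points are not all equal, i.e. when they affinely span \<open>\<real>\<close>.
  Rank 6 is injectivity of \<open>A\<close>, and \<open>\<Pi>\<close> is the range of \<open>A\<close>, of dimension \<open>rank A\<close>.\<close>

lemma Theta_nth:
  "Theta t $ 1 $ 1 = cos t" "Theta t $ 1 $ 2 = - sin t" "Theta t $ 1 $ 3 = 0"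
  "Theta t $ 2 $ 1 = sin t" "Theta t $ 2 $ 2 = cos t" "Theta t $ 2 $ 3 = 0"
  "Theta t $ 3 $ 1 = 0" "Theta t $ 3 $ 2 = 0" "Theta t $ 3 $ 3 = 1"
  by (simp_all add: Theta_def)

lemma orthogonal_matrix_Theta: "orthogonal_matrix (Theta t)"
  by (simp add: orthogonal_matrix_def matrix_matrix_mult_def transpose_def mat_def
      vec_eq_iff forall_3 sum_3 Theta_nth flip: power2_eq_square)

lemma gtheta_nth_3: "gtheta g t i $ 3 = g $ (i, 3)"
  by (simp add: gtheta_def matrix_vector_mult_def transpose_def blk_def sum_3 Theta_nth)

lemma matrix_vector_mult_nth: "(A *v x) $ k = (\<Sum>j\<in>UNIV. A $ k $ j * x $ j)"
  by (simp add: matrix_vector_mult_def)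

lemma diagm_mult_vec_nth: "(diagm s *v v) $ k = s $ k * v $ k"
  by (simp add: diagm_def matrix_vector_mult_def if_distrib if_distribR cong: if_cong)

lemma matrix_mult_diagm_nth: "(M ** diagm v) $ k $ j = M $ k $ j * v $ j"
  by (simp add: diagm_def matrix_matrix_mult_def if_distrib if_distribR cong: if_cong)

lemma orthogonal_matrix_mult_eq_0_iff:
  fixes Q :: "real^'n^'n"
  shows "orthogonal_matrix Q \<Longrightarrow> Q *v v = 0 \<longleftrightarrow> v = 0"
  by (metis orthogonal_matrix_def matrix_vector_mul_assoc matrix_vector_mul_lid
      matrix_vector_mult_0_right)

lemma surj_orthogonal_matrix_mult:
  fixes Q :: "real^'n^'n"
  shows "orthogonal_matrix Q \<Longrightarrow> surj ((*v) Q)"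
  by (metis orthogonal_matrix_def matrix_vector_mul_assoc matrix_vector_mul_lid surjI)

lemma inj_comp_bij_iff: "bij h \<Longrightarrow> inj (f \<circ> h) \<longleftrightarrow> inj f"
  by (metis bij_betw_def inj_compose inj_on_imageI)

lemma all_surj_iff: "surj f \<Longrightarrow> (\<forall>y. P y) \<longleftrightarrow> (\<forall>x. P (f x))"
  by (metis surjD)

lemma blk_eq_iff: "(\<forall>i. blk v i = blk w i) \<longleftrightarrow> v = w"
  by (auto simp: blk_def vec_eq_iff)

lemma blk_zero [simp]: "blk 0 i = 0"
  by (simp add: blk_def vec_eq_iff)

lemma stack_split: "v = stack (\<chi> j. v $ Inl j) (\<chi> j. v $ Inr j)"
  by (simp add: stack_def vec_eq_iff split: sum.split)

lemma all_stack_iff: "(\<forall>v. P v) \<longleftrightarrow> (\<forall>s \<tau>. P (stack s \<tau>))"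
  by (metis stack_split)

lemma range_matrix_mult_stack: "range ((*v) A) = {A *v stack s \<tau> | s \<tau>. True}"
proof (intro set_eqI iffI)
  fix h
  assume "h \<in> range ((*v) A)"
  then obtain v where "h = A *v v" by blast
  then show "h \<in> {A *v stack s \<tau> | s \<tau>. True}"
    by (subst (asm) stack_split) blast
qed blast

lemma bij_stack: "bij (\<lambda>(s, \<tau>). stack s \<tau>)"
  by (rule bij_betw_byWitness[where f' = "\<lambda>v. (\<chi> j. v $ Inl j, \<chi> j. v $ Inr j)"])
    (auto simp: stack_def vec_eq_iff split: sum.splits)

lemma stack_eq_0_iff: "stack s \<tau> = 0 \<longleftrightarrow> s = 0 \<and> \<tau> = 0"
  by (auto simp: stack_def vec_eq_iff split: sum.splits)

lemma blk_Amat_mult_stack: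
  "blk (Amat g t *v stack s \<tau>) i = Theta t *v (diagm s *v gtheta g t i) + \<tau>"
proof -
  have "(Amat g t *v stack s \<tau>) $ (i, k) =
      (\<Sum>j\<in>UNIV. (Theta t ** diagm (gtheta g t i)) $ k $ j * s $ j) + \<tau> $ k" for k
    by (simp add: matrix_vector_mult_nth Amat_def stack_def sum.Plus[of UNIV UNIV, simplified]
        if_distrib if_distribR cong: if_cong)
  then show ?thesis
    by (simp add: vec_eq_iff blk_def matrix_vector_mult_nth[of "Theta t"]
        matrix_mult_diagm_nth diagm_mult_vec_nth mult_ac)
qed

lemma Amat_mult_stack_Theta_eq_0_iff:
  "Amat g t *v stack s (Theta t *v c) = 0 \<longleftrightarrow> (\<forall>i k. s $ k * gtheta g t i $ k + c $ k = 0)"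
proof -
  have "blk (Amat g t *v stack s (Theta t *v c)) i = Theta t *v (diagm s *v gtheta g t i + c)" for i
    by (simp add: blk_Amat_mult_stack matrix_vector_right_distrib)
  then have "Amat g t *v stack s (Theta t *v c) = 0 \<longleftrightarrow> (\<forall>i. diagm s *v gtheta g t i + c = 0)"
    using blk_eq_iff[of "Amat g t *v stack s (Theta t *v c)" 0]
    by (simp add: orthogonal_matrix_mult_eq_0_iff orthogonal_matrix_Theta)
  then show ?thesis
    by (simp add: vec_eq_iff diagm_mult_vec_nth)
qed

lemma affinely_spans_iff_nonconstant:
  "affinely_spans (x :: 'n::finite \<Rightarrow> real) \<longleftrightarrow> (\<exists>i j. x i \<noteq> x j)"
proof
  assume spans: "affinely_spans x"
  show "\<exists>i j. x i \<noteq> x j"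
  proof (rule ccontr)
    assume "\<not> (\<exists>i j. x i \<noteq> x j)"
    then obtain x\<^sub>0 where const: "x = (\<lambda>_. x\<^sub>0)" by blast
    have "x\<^sub>0 + 1 \<in> {\<Sum>i\<in>UNIV. a i * x i | a. (\<Sum>i\<in>UNIV. a i) = 1}"
      using spans unfolding affinely_spans_def by simp
    then obtain a :: "'n \<Rightarrow> real"
      where "x\<^sub>0 + 1 = (\<Sum>i\<in>UNIV. a i) * x\<^sub>0" "(\<Sum>i\<in>UNIV. a i) = 1"
      unfolding const by (auto simp flip: sum_distrib_right)
    then show False by simp
  qed
next
  assume "\<exists>i j. x i \<noteq> x j"
  then obtain i j where ij: "x i - x j \<noteq> 0" by auto
  have "y \<in> {\<Sum>k\<in>UNIV. a k * x k | a. (\<Sum>k\<in>UNIV. a k) = 1}" for y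
  proof -
    define l where "l = (y - x j) / (x i - x j)"
    define a where "a k = (if k = i then l else 0) + (if k = j then 1 - l else 0)" for k
    have "a k * x k = (if k = i then l * x i else 0) + (if k = j then (1 - l) * x j else 0)" for k
      by (simp add: a_def distrib_right)
    then have "(\<Sum>k\<in>UNIV. a k * x k) = x j + l * (x i - x j)"
      by (simp add: sum.distrib algebra_simps)
    also have "\<dots> = y"
      using ij by (simp add: l_def)
    finally have "(\<Sum>k\<in>UNIV. a k * x k) = y" .
    moreover have "(\<Sum>k\<in>UNIV. a k) = 1"
      by (simp add: a_def sum.distrib)
    ultimately show ?thesis by blast
  qed
  then show "affinely_spans x"
    unfolding affinely_spans_def by blast
qed

lemma affine_vanishing_trivial_iff_nonconstant:
  fixes x :: "'n \<Rightarrow> real"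
  shows "(\<forall>a c. (\<forall>i. a * x i + c = 0) \<longrightarrow> a = 0 \<and> c = 0) \<longleftrightarrow> (\<exists>i j. x i \<noteq> x j)"
proof
  assume trivial: "\<forall>a c. (\<forall>i. a * x i + c = 0) \<longrightarrow> a = 0 \<and> c = 0"
  show "\<exists>i j. x i \<noteq> x j"
  proof (rule ccontr)
    assume "\<not> (\<exists>i j. x i \<noteq> x j)"
    then obtain x\<^sub>0 where "\<forall>i. x i = x\<^sub>0" by blast
    then have "\<forall>i. 1 * x i + - x\<^sub>0 = 0" by simp
    then show False using trivial[rule_format, of 1 "- x\<^sub>0"] by simp
  qed
next
  assume "\<exists>i j. x i \<noteq> x j"
  then obtain i j where ij: "x i - x j \<noteq> 0" by auto
  show "\<forall>a c. (\<forall>i. a * x i + c = 0) \<longrightarrow> a = 0 \<and> c = 0"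
  proof (intro allI impI)
    fix a c
    assume vanish: "\<forall>i. a * x i + c = 0"
    have "a * (x i - x j) = (a * x i + c) - (a * x j + c)"
      by (simp add: algebra_simps)
    with vanish ij have "a = 0" by simp
    with vanish show "a = 0 \<and> c = 0" by simp
  qed
qed

lemma vec_affine_vanishing_trivial_iff:
  fixes x :: "'n \<Rightarrow> real^'m"
  shows "(\<forall>s c :: real^'m. (\<forall>i k. s $ k * x i $ k + c $ k = 0) \<longrightarrow> s = 0 \<and> c = 0) \<longleftrightarrow>
    (\<forall>k. \<forall>a c. (\<forall>i. a * x i $ k + c = 0) \<longrightarrow> a = 0 \<and> c = 0)"
proof
  assume trivial: "\<forall>s c :: real^'m. (\<forall>i k. s $ k * x i $ k + c $ k = 0) \<longrightarrow> s = 0 \<and> c = 0"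
  show "\<forall>k a c. (\<forall>i. a * x i $ k + c = 0) \<longrightarrow> a = 0 \<and> c = 0"
  proof (intro allI impI)
    fix k a c
    assume "\<forall>i. a * x i $ k + c = 0"
    then have "\<forall>i k'. axis k a $ k' * x i $ k' + axis k c $ k' = 0"
      by (simp add: axis_def)
    with trivial have "axis k a = 0 \<and> axis k c = 0" by blast
    then show "a = 0 \<and> c = 0" by simp
  qed
next
  assume trivial: "\<forall>k a c. (\<forall>i. a * x i $ k + c = 0) \<longrightarrow> a = 0 \<and> c = 0"
  show "\<forall>s c :: real^'m. (\<forall>i k. s $ k * x i $ k + c $ k = 0) \<longrightarrow> s = 0 \<and> c = 0"
  proof (intro allI impI)
    fix s c :: "real^'m"
    assume "\<forall>i k. s $ k * x i $ k + c $ k = 0"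
    then have "s $ k = 0 \<and> c $ k = 0" for k
      using trivial by blast
    then show "s = 0 \<and> c = 0" by (simp add: vec_eq_iff)
  qed
qed

lemma inj_Amat_iff:
  "inj ((*v) (Amat g t)) \<longleftrightarrow> (\<forall>k. \<exists>i j. gtheta g t i $ k \<noteq> gtheta g t j $ k)"
proof -
  have "inj ((*v) (Amat g t)) \<longleftrightarrow> (\<forall>v. Amat g t *v v = 0 \<longrightarrow> v = 0)"
    by (rule linear_injective_0[OF matrix_vector_mul_linear])
  also have "\<dots> \<longleftrightarrow> (\<forall>s \<tau>. Amat g t *v stack s \<tau> = 0 \<longrightarrow> s = 0 \<and> \<tau> = 0)"
    by (simp only: all_stack_iff[where P = "\<lambda>v. Amat g t *v v = 0 \<longrightarrow> v = 0"] stack_eq_0_iff)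
  also have "\<dots> \<longleftrightarrow>
      (\<forall>s c. Amat g t *v stack s (Theta t *v c) = 0 \<longrightarrow> s = 0 \<and> Theta t *v c = 0)"
    by (intro all_cong1 all_surj_iff[OF surj_orthogonal_matrix_mult[OF orthogonal_matrix_Theta]])
  also have "\<dots> \<longleftrightarrow> (\<forall>s c. (\<forall>i k. s $ k * gtheta g t i $ k + c $ k = 0) \<longrightarrow> s = 0 \<and> c = 0)"
    by (simp only: Amat_mult_stack_Theta_eq_0_iff orthogonal_matrix_mult_eq_0_iff
        orthogonal_matrix_Theta)
  finally show ?thesis
    by (simp only: vec_affine_vanishing_trivial_iff affine_vanishing_trivial_iff_nonconstant)
qed

lemma Pi_space_eq_range: "Pi_space g t = range ((*v) (Amat g t))"
proof -
  have "(Theta t ** diagm s ** transpose (Theta t)) *v blk g i = Theta t *v (diagm s *v gtheta g t i)"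
    for s i
    by (simp add: gtheta_def matrix_vector_mul_assoc matrix_mul_assoc del: transpose_matrix_vector)
  then show ?thesis
    unfolding Pi_space_def range_matrix_mult_stack blk_eq_iff[symmetric]
    by (simp add: blk_Amat_mult_stack add.commute)
qed

theorem lemma3:
  fixes gt :: "real^('n::finite \<times> 3)" and \<theta> :: real
  shows "(inj (\<lambda>(s, \<tau>). Amat gt \<theta> *v stack s \<tau>)
          \<longleftrightarrow> rank (Amat gt \<theta>) = 6)
       \<and> (rank (Amat gt \<theta>) = 6 \<longleftrightarrow> dim (Pi_space gt \<theta>) = 6)
       \<and> (dim (Pi_space gt \<theta>) = 6 \<longleftrightarrow>
            (affinely_spans (\<lambda>i. gtheta gt \<theta> i $ 1)
             \<and> affinely_spans (\<lambda>i. gtheta gt \<theta> i $ 2)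
             \<and> affinely_spans (\<lambda>i. gt $ (i, 3))))"
proof -
  let ?A = "Amat gt \<theta>"
  have "(\<lambda>(s, \<tau>). ?A *v stack s \<tau>) = (*v) ?A \<circ> (\<lambda>(s, \<tau>). stack s \<tau>)"
    by auto
  then have inj_pair: "inj (\<lambda>(s, \<tau>). ?A *v stack s \<tau>) \<longleftrightarrow> inj ((*v) ?A)"
    by (simp add: inj_comp_bij_iff bij_stack)
  have rank: "rank ?A = 6 \<longleftrightarrow> inj ((*v) ?A)"
    using full_rank_injective[of ?A] by simp
  have dim: "dim (Pi_space gt \<theta>) = rank ?A"
    by (simp add: Pi_space_eq_range rank_dim_range)
  have "(\<lambda>i. gt $ (i, 3)) = (\<lambda>i. gtheta gt \<theta> i $ 3)"
    by (simp add: gtheta_nth_3)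
  then have spans: "inj ((*v) ?A) \<longleftrightarrow> affinely_spans (\<lambda>i. gtheta gt \<theta> i $ 1)
      \<and> affinely_spans (\<lambda>i. gtheta gt \<theta> i $ 2) \<and> affinely_spans (\<lambda>i. gt $ (i, 3))"
    by (simp add: inj_Amat_iff affinely_spans_iff_nonconstant forall_3)
  show ?thesis
    using inj_pair rank dim spans by simp
qed

end
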